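(* Let $\mathbb{F}\in\{\mathbb{R},\mathbb{C}\}$, let $K\geq 2$, and let $\mathcal{P}$ be an absolutely continuous probability measure on $\big(\mathbb{M}(n,\mathbb{F})\big)^K$. Then the set of tuples $\mathcal{A}=(A_1,\ldots,A_K)$ that have a common nontrivial invariant subspace has $\mathcal{P}$-measure zero. In particular, if $\mathcal{A}$ is drawn from $\mathcal{P}$, then with probability one it holds that $\lim_{Q\to Z,\ Q\in GL(n,\mathbb{F})}f_{\mathcal{A}}(Q)=\infty$ for all nonzero rank-deficient matrices $Z\in\mathbb{M}(n,\mathbb{F})$.
   Context: $\mathbb{M}(n,\mathbb{F})$ is the set of $n\times n$ matrices over $\mathbb{F}$ and $GL(n,\mathbb{F})$ its subset of invertible matrices. Lebesgue measure on $\mathbb{M}(n,\mathbb{F})$ is the one obtained by identifying $\mathbb{M}(n,\mathbb{F})$ linearly with $\mathbb{F}^{n^2}$ (unique up to a constant); a probability measure on $\big(\mathbb{M}(n,\mathbb{F})\big)^K$ is absolutely continuous if it is absolutely continuous with respect to the corresponding product Lebesgue measure. For $\mathcal{A}=(A_1,\ldots,A_K)$, the functional $f_{\mathcal{A}}:GL(n,\mathbb{F})\to[0,\infty)$ is $$f_{\mathcal{A}}(Q)=\frac12\sum_{k=1}^K\sum_{i\neq j}\left|(Q^{-1}A_kQ)_{ij}\right|^2.$$ A matrix is rank-deficient if its rank is less than $n$. A linear subspace $\mathcal{M}\subseteq\mathbb{F}^n$ is invariant for $A$ if $A(\mathcal{M})\subseteq\mathcal{M}$; it is nontrivial if it is neither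 $\{0\}$ nor $\mathbb{F}^n$. A common invariant subspace of several matrices is a subspace invariant for each of them. *)

theory Defs
  imports "HOL-Analysis.Analysis" "HOL-Probability.Probability"
begin

text \<open>
  The index types \<open>'n\<close> and \<open>'k\<close> play the roles of \<open>{1..n}\<close> and \<open>{1..K}\<close>, so a tuple of matrices
  \<open>(A\<^sub>1, \<dots>, A\<^sub>K)\<close> is an element of \<open>'a^'n^'n^'k\<close>. Subspaces are taken over the field \<open>'a\<close> of matrix
  entries (\<open>vec.subspace\<close>); for complex entries this is stronger than the real notion \<open>subspace\<close>.
\<close>

definition invariant_subspace :: "'a::field^'n^'n \<Rightarrow> ('a^'n) set \<Rightarrow> bool" where
  "invariant_subspace A M \<longleftrightarrow> vec.subspace M \<and> (*v) A ` M \<subseteq> M"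

definition has_common_nontrivial_invariant_subspace :: "'a::field^'n^'n^'k \<Rightarrow> bool" where
  "has_common_nontrivial_invariant_subspace A \<longleftrightarrow>
     (\<exists>M. M \<noteq> {0} \<and> M \<noteq> UNIV \<and> (\<forall>k. invariant_subspace (A $ k) M))"

text \<open>Only meaningful for invertible \<open>Q\<close>, since \<open>matrix_inv\<close> is unspecified otherwise.\<close>

definition offdiag_functional ::
    "'a::real_normed_field^'n^'n^'k \<Rightarrow> 'a^'n^'n \<Rightarrow> real" where
  "offdiag_functional A Q =
     1 / 2 * (\<Sum>k\<in>UNIV. \<Sum>(i, j)\<in>{(i, j). i \<noteq> j}.
       (norm ((matrix_inv Q ** A $ k ** Q) $ i $ j))\<^sup>2)"

text \<open>
  On \<open>'a^'n^'n^'k\<close> with real or complex entries, \<open>lborel\<close> is the product Lebesgue measure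
  (complex numbers being identified with pairs of reals), restricted to the Borel sets.
\<close>

definition abs_cont_prob :: "'b::euclidean_space measure \<Rightarrow> bool" where
  "abs_cont_prob P \<longleftrightarrow>
     prob_space P \<and> sets P = sets borel \<and> absolutely_continuous lborel P"

end

theory Submission
  imports Defs
begin

text \<open>
  Call a tuple of matrices reducible if its members have a common nontrivial invariant subspace.
  Two independent facts carry the result: reducible tuples form a Borel null set, and
  \<open>offdiag_functional A\<close> blows up at every nonzero singular \<open>Z\<close> as soon as \<open>A\<close> is irreducible.

  \<^bold>\<open>Null set.\<close> Let \<open>\<Lambda>\<close> be diagonal with distinct entries \<open>\<lambda>\<^sub>p\<close> and let \<open>J\<close> be the all-ones matrix.
  The noncommutative polynomials
  \<open>W\<^sub>p\<^sub>q(A, B) = (\<Prod>r\<noteq>p. A - \<lambda>\<^sub>r) B (\<Prod>r\<noteq>q. A - \<lambda>\<^sub>r)\<close>, evaluated at \<open>(\<Lambda>, J)\<close>, are nonzero multiples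
  of the matrix units, hence linearly independent. At a pair with a common invariant subspace they are
  dependent: they all map that subspace into itself, so a functional
  \<open>X \<mapsto> w X v\<close>, with \<open>v\<close> in the subspace and \<open>w\<close> vanishing on it, kills them. Hence the determinant of
  the \<open>n\<^sup>2 \<times> n\<^sup>2\<close> array of their entries vanishes on reducible pairs but not at \<open>(\<Lambda>, J)\<close>
  (\<open>det_word_matrix_eq_0\<close>, \<open>det_word_matrix_diagonal_ones\<close>). If \<open>D\<close> is a tuple with entries
  \<open>\<Lambda>\<close> and \<open>J\<close>, this determinant along \<open>D + s A\<close> is a polynomial in \<open>s\<close> that is nonzero at
  \<open>s = 0\<close>, so it has finitely many roots. As reducibility is invariant under scaling, every line
  \<open>A + t D\<close> contains only finitely many reducible tuples, and a Borel set that meets all parallels to a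
  fixed direction in countable sets is null by Fubini (\<open>null_if_lines_countable\<close>). The argument is the
  same over the real and the complex numbers.

  The set is Borel because reducibility of \<open>A\<close> means that some nonzero singular \<open>P\<close> satisfies
  \<open>A\<^sub>k P = P A\<^sub>k P\<close> for all \<open>k\<close>: this exhibits the set as a projection of a \<open>\<sigma>\<close>-compact one.

  \<^bold>\<open>Blow-up.\<close> If \<open>A\<close> is irreducible, the range of \<open>Z\<close> is not invariant, so a functional \<open>w\<close>
  vanishes on all columns of \<open>Z\<close> but not on \<open>A\<^sub>k z\<^sub>j\<close> for some column \<open>z\<^sub>j\<close>. For \<open>Q\<close> near \<open>Z\<close> with
  columns \<open>q\<^sub>i\<close>, correct \<open>w\<close> by a small multiple of a coordinate functional to a functional \<open>x\<close> with
  \<open>x q\<^sub>j = 0\<close>. Writing \<open>A\<^sub>k Q = Q B\<close>, we get \<open>x A\<^sub>k q\<^sub>j = (\<Sum>i\<noteq>j. B\<^sub>i\<^sub>j x q\<^sub>i)\<close>, where the diagonal entry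
  of \<open>B\<close> has dropped out. The left side stays away from \<open>0\<close> while all \<open>x q\<^sub>i\<close> tend to \<open>0\<close>, so
  the largest off-diagonal entry of \<open>B\<close> tends to infinity (\<open>offdiag_functional_lower\<close>,
  \<open>offdiag_functional_at_top\<close>).
\<close>

section \<open>Common invariant subspaces as a matrix equation\<close>

text \<open>
  Any projection onto \<open>M\<close> serves as \<open>P\<close>. It presents \<open>M\<close> both as the range of \<open>P\<close> and as the kernel of
  \<open>mat 1 - P\<close>; the rows of the latter are the functionals that separate points from \<open>M\<close>.
\<close>

lemma subspace_projection_matrix:
  fixes M :: "('a::field^'n) set"
  assumes "vec.subspace M"
  obtains P :: "'a^'n^'n" where "range ((*v) P) = M" "\<And>x. x \<in> M \<longleftrightarrow> P *v x = x"
proof -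
  obtain g where g: "range g \<subseteq> M" "Vector_Spaces.linear (*s) (*s) g" "\<forall>v\<in>M. g (id v) = v"
    using vec.linear_exists_left_inverse_on[OF vec.linear_id assms] by auto
  have eq: "matrix g *v x = g x" for x
    using matrix_works g(2) by blast
  show ?thesis
    by (rule that[of "matrix g"]) (use g in \<open>auto simp: eq image_def; metis rangeI subsetD\<close>)+
qed

text \<open>
  A witness \<open>P\<close> is a projection onto the invariant subspace; conversely the range of any witness is
  invariant. Apart from \<open>P \<noteq> 0\<close>, the conditions on the witness are closed in \<open>(A, P)\<close>, which makes
  this form suitable for proving measurability.
\<close>

lemma reducible_iff_matrix_equation:
  fixes A :: "'a::field^'n^'n^'k"
  shows "has_common_nontrivial_invariant_subspace A \<longleftrightarrow>
    (\<exists>P. P \<noteq> 0 \<and> det P = 0 \<and> (\<forall>k. A $ k ** P = P ** A $ k ** P))"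
proof
  assume "has_common_nontrivial_invariant_subspace A"
  then obtain M where M: "M \<noteq> {0}" "M \<noteq> UNIV" "\<And>k. vec.subspace M" "\<And>k. (*v) (A $ k) ` M \<subseteq> M"
    unfolding has_common_nontrivial_invariant_subspace_def invariant_subspace_def by blast
  obtain P where P: "range ((*v) P) = M" "\<And>x. x \<in> M \<longleftrightarrow> P *v x = x"
    using subspace_projection_matrix[OF M(3)] by blast
  have "P \<noteq> 0"
    using P(1) M(1) by auto
  moreover have "det P = 0"
  proof (rule ccontr)
    assume "det P \<noteq> 0"
    then have "surj ((*v) P)"
      by (metis invertible_det_nz invertible_right_inverse matrix_right_invertible_surjective)
    with P(1) M(2) show False by simp
  qed
  moreover have "A $ k ** P = P ** A $ k ** P" for k
  proof -
    have "A $ k *v (P *v x) = P *v (A $ k *v (P *v x))" for x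
      using P M(4)[of k] by (metis image_subset_iff rangeI)
    then show ?thesis
      by (simp add: matrix_eq matrix_vector_mul_assoc matrix_mul_assoc)
  qed
  ultimately show "\<exists>P. P \<noteq> 0 \<and> det P = 0 \<and> (\<forall>k. A $ k ** P = P ** A $ k ** P)" by blast
next
  assume "\<exists>P. P \<noteq> 0 \<and> det P = 0 \<and> (\<forall>k. A $ k ** P = P ** A $ k ** P)"
  then obtain P where P: "P \<noteq> 0" "det P = 0" "\<And>k. A $ k ** P = P ** A $ k ** P" by blast
  have "vec.subspace (range ((*v) P))"
    using vec.linear_subspace_image[OF matrix_vector_mul_linear_gen vec.subspace_UNIV] .
  moreover have "range ((*v) P) \<noteq> {0}"
    using P(1) by (auto simp: matrix_eq)
  moreover have "range ((*v) P) \<noteq> UNIV"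
    using P(2) by (metis invertible_det_nz invertible_right_inverse matrix_right_invertible_surjective)
  moreover have "A $ k *v (P *v x) \<in> range ((*v) P)" for k x
    using P(3)[of k] by (metis matrix_vector_mul_assoc rangeI)
  ultimately show "has_common_nontrivial_invariant_subspace A"
    unfolding has_common_nontrivial_invariant_subspace_def invariant_subspace_def
    by (intro exI[of _ "range ((*v) P)"]) (simp add: image_subset_iff)
qed

section \<open>Borel measurability of reducibility\<close>

lemma continuous_on_matrix_mult:
  fixes f :: "'b::topological_space \<Rightarrow> 'a::real_normed_field^'n^'m" and g :: "'b \<Rightarrow> 'a^'p^'n"
  assumes "continuous_on S f" "continuous_on S g"
  shows "continuous_on S (\<lambda>x. f x ** g x)"
  unfolding matrix_matrix_mult_def using assms
  by (intro continuous_intros continuous_on_vec_lambda)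

lemma continuous_on_matrix_det:
  fixes f :: "'b::topological_space \<Rightarrow> 'a::real_normed_field^'n^'n"
  assumes "continuous_on S f"
  shows "continuous_on S (\<lambda>x. det (f x))"
  unfolding det_def using assms
  by (intro continuous_intros)

text \<open>
  The pairs \<open>(A, P)\<close> satisfying the closed conditions of \<open>reducible_iff_matrix_equation\<close> together with
  \<open>P \<noteq> 0\<close> are a countable union of compact sets, and projecting to \<open>A\<close> preserves this.
\<close>

lemma borel_reducible:
  "{A :: 'a::{real_normed_field,euclidean_space}^'n^'n^'k. has_common_nontrivial_invariant_subspace A} \<in> sets borel"
proof -
  define T :: "(('a^'n^'n^'k) \<times> ('a^'n^'n)) set"
    where "T = {(A, P). det P = 0 \<and> (\<forall>k. A $ k ** P = P ** A $ k ** P)}"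
  \<comment> \<open>The lower bound on the norm in the second factor exhausts the open condition \<open>P \<noteq> 0\<close> by compact sets.\<close>
  define B :: "nat \<Rightarrow> (('a^'n^'n^'k) \<times> ('a^'n^'n)) set"
    where "B m = cball 0 m \<times> (cball 0 m - ball 0 (inverse (Suc m)))" for m
  have "closed T"
    unfolding T_def case_prod_unfold
    by (intro closed_Collect_conj closed_Collect_all closed_Collect_eq continuous_on_matrix_mult
        continuous_on_matrix_det continuous_intros)
  moreover have "compact (B m)" for m
    unfolding B_def by (intro compact_Times compact_cball compact_diff open_ball)
  ultimately have "closed (fst ` (T \<inter> B m))" for m
    using closed_Int_compact by (intro compact_imp_closed compact_continuous_image continuous_intros) blast
  then have "(\<Union>m. fst ` (T \<inter> B m)) \<in> sets borel"
    by (intro sets.countable_UN) auto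
  also have "(\<Union>m. fst ` (T \<inter> B m)) = {A. has_common_nontrivial_invariant_subspace A}"
  proof -
    have ex_m: "\<exists>m. (A, P) \<in> B m" if "P \<noteq> 0" for A P
    proof -
      obtain m1 :: nat where m1: "norm A + norm P \<le> real m1"
        using real_arch_simple by blast
      obtain m2 :: nat where m2: "inverse (real (Suc m2)) < norm P"
        using reals_Archimedean[of "norm P"] \<open>P \<noteq> 0\<close> by auto
      have "inverse (real (Suc (max m1 m2))) \<le> inverse (real (Suc m2))"
        by (intro le_imp_inverse_le) auto
      with m2 have "inverse (real (Suc (max m1 m2))) \<le> norm P"
        by linarith
      moreover have "norm A \<le> real (max m1 m2)" "norm P \<le> real (max m1 m2)"
        using m1 norm_ge_zero[of A] norm_ge_zero[of P] unfolding of_nat_max by linarith+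
      ultimately have "(A, P) \<in> B (max m1 m2)"
        unfolding B_def by (simp del: of_nat_max of_nat_Suc)
      then show ?thesis ..
    qed
    have nz: "P \<noteq> 0" if "(A, P) \<in> B m" for A P m
      using that unfolding B_def by auto
    have "(\<Union>m. fst ` (T \<inter> B m)) = {A. \<exists>P. P \<noteq> 0 \<and> (A, P) \<in> T}"
    proof (intro equalityI subsetI)
      fix A assume "A \<in> (\<Union>m. fst ` (T \<inter> B m))"
      then obtain m P where "(A, P) \<in> T" "(A, P) \<in> B m" by auto
      then show "A \<in> {A. \<exists>P. P \<noteq> 0 \<and> (A, P) \<in> T}" using nz[of A P m] by blast
    next
      fix A assume "A \<in> {A. \<exists>P. P \<noteq> 0 \<and> (A, P) \<in> T}"
      then obtain P where P: "P \<noteq> 0" "(A, P) \<in> T" by blast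
      obtain m where "(A, P) \<in> B m" using ex_m[OF P(1)] by blast
      with P(2) have "A \<in> fst ` (T \<inter> B m)" by (intro image_eqI[of _ _ "(A, P)"]) simp_all
      then show "A \<in> (\<Union>m. fst ` (T \<inter> B m))" by (rule UN_I[OF UNIV_I])
    qed
    then show ?thesis
      by (simp only: reducible_iff_matrix_equation T_def mem_Collect_eq case_prod_conv)
  qed
  finally show ?thesis .
qed

section \<open>A noncommutative polynomial that detects irreducibility\<close>

text \<open>
  The product of the matrices \<open>A - l q\<close> over the list \<open>qs\<close>; a list fixes the order of the factors. If
  \<open>l\<close> lists the eigenvalues of a diagonal \<open>A\<close> and \<open>qs\<close> omits just \<open>p\<close>, this is a multiple of the
  projection onto the \<open>p\<close>-th coordinate. The entries lie in a commutative ring so that polynomial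
  entries are covered.
\<close>

definition spectral_product :: "('n \<Rightarrow> 'a::comm_ring_1) \<Rightarrow> 'n list \<Rightarrow> 'a^'n^'n \<Rightarrow> 'a^'n^'n" where
  "spectral_product l qs A = foldr (\<lambda>q X. (A - mat (l q)) ** X) qs (mat 1)"

text \<open>
  Row \<open>(p, q)\<close> holds the entries of the word \<open>W\<^sub>p\<^sub>q(A, B)\<close>. The intended \<open>L p\<close> enumerates all
  indices other than \<open>p\<close>.
\<close>

definition word_matrix ::
    "('n \<Rightarrow> 'a::comm_ring_1) \<Rightarrow> ('n \<Rightarrow> 'n list) \<Rightarrow> 'a^'n^'n \<Rightarrow> 'a^'n^'n \<Rightarrow> 'a^('n \<times> 'n)^('n \<times> 'n)" where
  "word_matrix l L A B = (\<chi> a b.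
     (spectral_product l (L (fst a)) A ** B ** spectral_product l (L (snd a)) A) $ fst b $ snd b)"

definition eval_matrix :: "'a::comm_ring_1 \<Rightarrow> 'a poly^'n^'m \<Rightarrow> 'a^'n^'m" where
  "eval_matrix s X = (\<chi> i j. poly (X $ i $ j) s)"

lemma eval_matrix_mult: "eval_matrix s (X ** Y) = eval_matrix s X ** eval_matrix s Y"
  by (simp add: eval_matrix_def matrix_matrix_mult_def vec_eq_iff poly_sum)

lemma eval_matrix_diff: "eval_matrix s (X - Y) = eval_matrix s X - eval_matrix s Y"
  by (simp add: eval_matrix_def vec_eq_iff)

lemma eval_matrix_mat: "eval_matrix s (mat c) = mat (poly c s)"
  by (simp add: eval_matrix_def mat_def vec_eq_iff)

lemma poly_det: "poly (det X) s = det (eval_matrix s X)"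
  by (simp add: det_def eval_matrix_def poly_sum poly_prod)

lemma eval_spectral_product:
  "eval_matrix s (spectral_product l qs A) = spectral_product (\<lambda>q. poly (l q) s) qs (eval_matrix s A)"
  by (induction qs)
    (simp_all add: spectral_product_def eval_matrix_mult eval_matrix_diff eval_matrix_mat)

text \<open>
  Evaluation at \<open>s\<close> is a ring homomorphism, so the determinant of the word matrix of a polynomial family
  of matrices is one polynomial whose values are the determinants for the members of the family.
\<close>

lemma eval_word_matrix:
  "eval_matrix s (word_matrix l L A B) =
     word_matrix (\<lambda>q. poly (l q) s) L (eval_matrix s A) (eval_matrix s B)"
proof -
  have "eval_matrix s (word_matrix l L A B) = (\<chi> a b. eval_matrix s
      (spectral_product l (L (fst a)) A ** B ** spectral_product l (L (snd a)) A) $ fst b $ snd b)"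
    by (simp add: eval_matrix_def word_matrix_def vec_eq_iff)
  then show ?thesis
    by (simp add: word_matrix_def eval_matrix_mult eval_spectral_product)
qed

lemma mat_mult_vector: "(mat c :: 'a::comm_ring_1^'n^'n) *v x = c *s x"
  by (simp add: mat_def matrix_vector_mult_def vec_eq_iff if_distrib[of "\<lambda>y. y * _"] cong: if_cong)

lemma spectral_product_invariant:
  fixes A :: "'a::field^'n^'n"
  assumes "invariant_subspace A M" "x \<in> M"
  shows "spectral_product l qs A *v x \<in> M"
proof (induction qs)
  case Nil
  then show ?case using assms(2) by (simp add: spectral_product_def)
next
  case (Cons q qs)
  let ?y = "spectral_product l qs A *v x"
  have "spectral_product l (q # qs) A *v x = A *v ?y - l q *s ?y"
    by (simp add: spectral_product_def matrix_vector_mult_diff_rdistrib mat_mult_vector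
        flip: matrix_vector_mul_assoc)
  also have "\<dots> \<in> M"
    using assms(1) Cons.IH unfolding invariant_subspace_def
    by (auto intro!: vec.subspace_diff vec.subspace_scale)
  finally show ?case .
qed

text \<open>
  With \<open>v\<close> in \<open>M\<close> and \<open>w\<close> a functional vanishing on \<open>M\<close>, both nonzero, each word \<open>W\<close> maps \<open>v\<close> into
  \<open>M\<close>, so that \<open>w W v = 0\<close>. Read as a linear relation between the entries of \<open>W\<close>, this says
  that the tensor of \<open>w\<close> and \<open>v\<close> lies in the kernel of the word matrix.
\<close>

lemma det_word_matrix_eq_0:
  fixes A B :: "'a::field^'n^'n"
  assumes A: "invariant_subspace A M" and B: "invariant_subspace B M"
    and M: "M \<noteq> {0}" "M \<noteq> UNIV"
  shows "det (word_matrix l L A B) = 0"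
proof -
  have sub: "vec.subspace M" using A by (simp add: invariant_subspace_def)
  then obtain v where v: "v \<in> M" "v \<noteq> 0"
    using M(1) vec.subspace_0 by blast
  obtain P where P: "range ((*v) P) = M" "\<And>x. x \<in> M \<longleftrightarrow> P *v x = x"
    using subspace_projection_matrix[OF sub] by blast
  obtain y where "P *v y \<noteq> y" using P(2) M(2) by blast
  then obtain r where r: "(P *v y) $ r \<noteq> y $ r" by (auto simp: vec_eq_iff)
  define w where "w = (mat 1 - P) $ r"
  have w: "((mat 1 - P) *v x) $ r = (\<Sum>i\<in>UNIV. w $ i * x $ i)" for x
    by (simp add: matrix_vector_mult_def w_def)
  have w_M: "(\<Sum>i\<in>UNIV. w $ i * x $ i) = 0" if "x \<in> M" for x
    using that P(2) unfolding w[symmetric] by (simp add: matrix_vector_mult_diff_rdistrib)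
  have "w \<noteq> 0"
  proof
    assume "w = 0"
    then have "((mat 1 - P) *v y) $ r = 0" unfolding w by simp
    with r show False by (simp add: matrix_vector_mult_diff_rdistrib)
  qed
  define u :: "'a^('n \<times> 'n)" where "u = (\<chi> b. w $ fst b * v $ snd b)"
  obtain i j where "w $ i \<noteq> 0" "v $ j \<noteq> 0"
    using \<open>w \<noteq> 0\<close> v(2) by (auto simp: vec_eq_iff)
  then have "u $ (i, j) \<noteq> 0" by (simp add: u_def)
  then have "u \<noteq> 0" by auto
  have "word_matrix l L A B *v u = 0"
  proof -
    have "(word_matrix l L A B *v u) $ a = 0" for a
    proof -
      let ?W = "spectral_product l (L (fst a)) A ** B ** spectral_product l (L (snd a)) A"
      have "(word_matrix l L A B *v u) $ a = (\<Sum>i\<in>UNIV. \<Sum>j\<in>UNIV. ?W $ i $ j * (w $ i * v $ j))"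
        by (simp add: matrix_vector_mult_def word_matrix_def u_def sum.cartesian_product case_prod_unfold
            flip: UNIV_Times_UNIV)
      also have "\<dots> = (\<Sum>i\<in>UNIV. w $ i * (?W *v v) $ i)"
        by (simp add: matrix_vector_mult_def sum_distrib_left mult_ac)
      also have "?W *v v \<in> M"
        using v(1) B unfolding matrix_vector_mul_assoc[symmetric] invariant_subspace_def
        by (intro spectral_product_invariant[OF A]) (auto intro: spectral_product_invariant[OF A])
      then have "(\<Sum>i\<in>UNIV. w $ i * (?W *v v) $ i) = 0" by (rule w_M)
      finally show ?thesis .
    qed
    then show ?thesis by (simp add: vec_eq_iff)
  qed
  with \<open>u \<noteq> 0\<close> show ?thesis
    by (metis invertible_det_nz invertible_left_inverse matrix_left_invertible_ker)
qed

definition diagonal_matrix :: "('n \<Rightarrow> 'a::zero) \<Rightarrow> 'a^'n^'n" where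
  "diagonal_matrix l = (\<chi> i j. if i = j then l i else 0)"

lemma spectral_product_diagonal:
  "spectral_product l qs (diagonal_matrix l) = diagonal_matrix (\<lambda>i. \<Prod>q\<leftarrow>qs. l i - l q)"
proof (induction qs)
  case Nil
  then show ?case by (simp add: spectral_product_def diagonal_matrix_def mat_def vec_eq_iff)
next
  case (Cons q qs)
  have "spectral_product l (q # qs) (diagonal_matrix l) =
      (diagonal_matrix l - mat (l q)) ** diagonal_matrix (\<lambda>i. \<Prod>q\<leftarrow>qs. l i - l q)"
    using Cons.IH by (simp add: spectral_product_def)
  also have "diagonal_matrix l - mat (l q) = diagonal_matrix (\<lambda>i. l i - l q)"
    by (simp add: diagonal_matrix_def mat_def vec_eq_iff)
  finally show ?case
    by (simp add: diagonal_matrix_def matrix_matrix_mult_def vec_eq_iff if_distrib[of "\<lambda>y. y * _"] cong: if_cong)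
qed

text \<open>
  Here both spectral products are nonzero multiples of matrix units \<open>E\<^sub>p\<^sub>p\<close> and \<open>E\<^sub>q\<^sub>q\<close>, and the all-ones
  matrix between them turns the word into a nonzero multiple of \<open>E\<^sub>p\<^sub>q\<close>. The word matrix is therefore diagonal.
\<close>

lemma det_word_matrix_diagonal_ones:
  fixes l :: "'n::finite \<Rightarrow> 'a::field"
  assumes l: "inj l" and L: "\<And>p. set (L p) = UNIV - {p}"
  shows "det (word_matrix l L (diagonal_matrix l) (\<chi> i j. 1)) \<noteq> 0"
proof -
  define c where "c p i = (\<Prod>q\<leftarrow>L p. l i - l q)" for p i
  have c0: "c p i = 0 \<longleftrightarrow> i \<noteq> p" for p i
    using L[of p] l by (auto simp: c_def prod_list_zero_iff inj_eq image_iff)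
  have sp: "spectral_product l (L p) (diagonal_matrix l) = diagonal_matrix (c p)" for p
    by (simp add: spectral_product_diagonal c_def[abs_def])
  have W: "word_matrix l L (diagonal_matrix l) (\<chi> i j. 1) $ a $ b = c (fst a) (fst b) * c (snd a) (snd b)" for a b
    unfolding word_matrix_def sp
    by (simp add: diagonal_matrix_def matrix_matrix_mult_def if_distrib[of "\<lambda>y. y * _"]
        if_distrib[of "\<lambda>y. _ * y"] cong: if_cong)
  have "det (word_matrix l L (diagonal_matrix l) (\<chi> i j. 1)) = 
    (\<Prod>a\<in>UNIV. word_matrix l L (diagonal_matrix l) (\<chi> i j. 1) $ a $ a)"
    by (rule det_diagonal) (auto simp: W c0 prod_eq_iff)
  then show ?thesis by (simp add: W c0)
qed

section \<open>Reducible tuples form a null set\<close>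

text \<open>
  Integrate the indicator of \<open>S\<close> at \<open>x + t d\<close> over all \<open>x\<close> and over \<open>t\<close> in the unit interval. For fixed
  \<open>t\<close> translation invariance gives the measure of \<open>S\<close>; for fixed \<open>x\<close> countability gives \<open>0\<close>.
\<close>

lemma null_if_lines_countable:
  fixes S :: "'a::euclidean_space set"
  assumes S: "S \<in> sets borel" and c: "\<And>x. countable {t::real. x + t *\<^sub>R d \<in> S}"
  shows "S \<in> null_sets lborel"
proof -
  let ?f = "\<lambda>(x, t::real). indicator {0..1} t * indicator S (x + t *\<^sub>R d) :: ennreal"
  have [measurable]: "S \<in> sets borel" by (rule S)
  have meas: "?f \<in> borel_measurable (lborel \<Otimes>\<^sub>M lborel)"
    by measurable
  have "(\<integral>\<^sup>+x. indicator S (x + t *\<^sub>R d) \<partial>lborel) = emeasure lborel S" for t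
  proof -
    have "emeasure lborel S = (\<integral>\<^sup>+x. indicator S x \<partial>distr lborel borel ((+) (t *\<^sub>R d)))"
      using S by (simp add: lborel_distr_plus)
    also have "\<dots> = (\<integral>\<^sup>+x. indicator S (x + t *\<^sub>R d) \<partial>lborel)"
      by (subst nn_integral_distr) (auto simp: add.commute)
    finally show ?thesis ..
  qed
  then have "(\<integral>\<^sup>+t. \<integral>\<^sup>+x. ?f (x, t) \<partial>lborel \<partial>lborel) = (\<integral>\<^sup>+t. indicator {0..1::real} t * emeasure lborel S \<partial>lborel)"
    by (simp add: nn_integral_cmult)
  also have "\<dots> = emeasure lborel S"
    by (simp add: nn_integral_multc)
  finally have "emeasure lborel S = (\<integral>\<^sup>+x. \<integral>\<^sup>+t. ?f (x, t) \<partial>lborel \<partial>lborel)"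
    using lborel_pair.Fubini[OF meas] by simp
  moreover have inner: "(\<integral>\<^sup>+t. ?f (x, t) \<partial>lborel) = 0" for x
  proof -
    have "AE t in lborel. t \<notin> {t. x + t *\<^sub>R d \<in> S}"
      using countable_imp_null_set_lborel[OF c[of x]] by (rule AE_not_in)
    then have "AE t in lborel. ?f (x, t) = 0"
      by eventually_elim auto
    then show ?thesis
      using nn_integral_cong_AE[of "\<lambda>t. ?f (x, t)" "\<lambda>_. 0" lborel] by simp
  qed
  ultimately have "emeasure lborel S = 0"
    by (simp only: inner nn_integral_const mult_zero_left)
  then show ?thesis using S by (simp add: null_sets_def)
qed

text \<open>
  The exceptional \<open>s\<close> are roots of the determinant of the word matrix, a polynomial in \<open>s\<close> that does not
  vanish at \<open>s = 0\<close>.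
\<close>

lemma finite_reducible_perturbations:
  fixes D A :: "'a::{real_normed_field,euclidean_space}^'n^'n^'k"
  assumes l: "inj l"
    and D: "D $ k1 = diagonal_matrix l" "D $ k2 = (\<chi> i j. 1)"
  shows "finite {s::real. has_common_nontrivial_invariant_subspace (D + s *\<^sub>R A)}"
proof -
  have "\<exists>xs. set xs = UNIV - {p}" for p :: 'n
    by (intro finite_list) simp
  then obtain L where L: "\<And>p::'n. set (L p) = UNIV - {p}" by metis
  define X :: "'k \<Rightarrow> 'a poly^'n^'n" where "X k = (\<chi> i j. [:D $ k $ i $ j, A $ k $ i $ j:])" for k
  define g where "g = det (word_matrix (\<lambda>q. [:l q:]) L (X k1) (X k2))"
  have X: "eval_matrix (of_real s) (X k) = (D + s *\<^sub>R A) $ k" for s k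
    unfolding eval_matrix_def X_def by (simp add: vec_eq_iff) (simp add: scaleR_conv_of_real)
  have g: "poly g (of_real s) = det (word_matrix l L ((D + s *\<^sub>R A) $ k1) ((D + s *\<^sub>R A) $ k2))" for s
    by (simp only: g_def poly_det eval_word_matrix X) simp
  have "poly g (of_real 0) \<noteq> 0"
    unfolding g using det_word_matrix_diagonal_ones[OF l L] D by simp
  then have "g \<noteq> 0" by auto
  then have "finite {z. poly g z = 0}" by (rule poly_roots_finite)
  then have "finite (of_real -` {z. poly g z = 0} :: real set)"
    by (rule finite_vimageI) (simp add: inj_def)
  moreover have "poly g (of_real s) = 0"
    if "has_common_nontrivial_invariant_subspace (D + s *\<^sub>R A)" for s
    unfolding g using that det_word_matrix_eq_0
    unfolding has_common_nontrivial_invariant_subspace_def by blast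
  then have "{s::real. has_common_nontrivial_invariant_subspace (D + s *\<^sub>R A)} \<subseteq> of_real -` {z. poly g z = 0}"
    by blast
  ultimately show ?thesis by (rule finite_subset[rotated])
qed

lemma reducible_scaleR:
  fixes A :: "'a::real_normed_field^'n^'n^'k"
  assumes "has_common_nontrivial_invariant_subspace A"
  shows "has_common_nontrivial_invariant_subspace (c *\<^sub>R A)"
proof -
  have "(c *\<^sub>R A) $ k *v x = of_real c *s (A $ k *v x)" for k x
    by (simp add: vec_eq_iff matrix_vector_mult_def sum_distrib_left scaleR_conv_of_real[where 'a='a] mult.assoc)
  then show ?thesis
    using assms unfolding has_common_nontrivial_invariant_subspace_def invariant_subspace_def
    by (fastforce intro: vec.subspace_scale)
qed

text \<open>
  On the line \<open>A + t D\<close> the points with \<open>t \<noteq> 0\<close> are multiples of \<open>D + (1/t) A\<close>, which moves the point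
  at infinity of the line, where irreducibility is known, to a finite parameter.
\<close>

lemma null_sets_reducible:
  assumes "CARD('k::finite) \<ge> 2"
  shows "{A :: 'a::{real_normed_field,euclidean_space}^'n^'n^'k. has_common_nontrivial_invariant_subspace A} \<in> null_sets lborel"
proof -
  obtain k1 k2 :: 'k where k: "k1 \<noteq> k2"
    using assms by (metis (full_types) card_2_iff' ex_card UNIV_I)
  define l :: "'n \<Rightarrow> 'a" where "l i = of_nat (to_nat i)" for i
  have l: "inj l" by (auto simp: l_def inj_def)
  define D :: "'a^'n^'n^'k" where "D = (\<chi> k. if k = k1 then diagonal_matrix l else (\<chi> i j. 1))"
  show ?thesis
  proof (rule null_if_lines_countable[where d = D, OF borel_reducible])
    fix A :: "'a^'n^'n^'k"
    let ?S = "{t::real. has_common_nontrivial_invariant_subspace (A + t *\<^sub>R D)}"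
    have "?S \<subseteq> insert 0 (inverse ` {s. has_common_nontrivial_invariant_subspace (D + s *\<^sub>R A)})"
    proof
      fix t assume t: "t \<in> ?S"
      show "t \<in> insert 0 (inverse ` {s. has_common_nontrivial_invariant_subspace (D + s *\<^sub>R A)})"
      proof (cases "t = 0")
        case False
        have "has_common_nontrivial_invariant_subspace (inverse t *\<^sub>R (A + t *\<^sub>R D))"
          using reducible_scaleR t by blast
        then have "has_common_nontrivial_invariant_subspace (D + inverse t *\<^sub>R A)"
          using False by (simp add: scaleR_add_right add.commute)
        then show ?thesis by (auto intro: image_eqI[of _ _ "inverse t"])
      qed simp
    qed
    moreover have "finite {s::real. has_common_nontrivial_invariant_subspace (D + s *\<^sub>R A)}"
      using k by (intro finite_reducible_perturbations[OF l, of _ k1 k2]) (auto simp: D_def)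
    ultimately have "finite ?S" by (meson finite_imageI finite_insert finite_subset)
    then show "countable {t. A + t *\<^sub>R D \<in> {A. has_common_nontrivial_invariant_subspace A}}"
      by (simp add: countable_finite)
  qed
qed

section \<open>Blow-up of the functional at singular matrices\<close>

lemma det_eq_0_if_rank_less:
  fixes Z :: "'a::field^'n^'n"
  assumes "rank Z < CARD('n)"
  shows "det Z = 0"
proof (rule ccontr)
  assume "det Z \<noteq> 0"
  then have "vec.span (rows Z) = UNIV"
    by (metis invertible_det_nz invertible_left_inverse matrix_left_invertible_span_rows_gen)
  then have "vec.dim (rows Z) = CARD('n)"
    by (metis vec.dim_span vec_dim_card)
  with assms show False by (simp add: row_rank_def_gen)
qed

lemma offdiag_entry_le:
  assumes "i \<noteq> j"
  shows "(norm ((matrix_inv Q ** A $ k ** Q) $ i $ j))\<^sup>2 \<le> 2 * offdiag_functional A Q"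
proof -
  let ?h = "\<lambda>k. \<lambda>(i, j). (norm ((matrix_inv Q ** A $ k ** Q) $ i $ j))\<^sup>2"
  have "?h k (i, j) \<le> (\<Sum>p\<in>{(i, j). i \<noteq> j}. ?h k p)"
    using assms by (intro member_le_sum) auto
  also have "\<dots> \<le> (\<Sum>k\<in>UNIV. \<Sum>p\<in>{(i, j). i \<noteq> j}. ?h k p)"
    by (rule member_le_sum[of k UNIV "\<lambda>k. \<Sum>p\<in>{(i, j). i \<noteq> j}. ?h k p"]) (auto intro: sum_nonneg)
  also have "\<dots> = 2 * offdiag_functional A Q"
    by (simp add: offdiag_functional_def)
  finally show ?thesis by simp
qed

lemma matrix_inv_right_inverse:
  fixes Q :: "'a::field^'n^'n"
  assumes "invertible Q"
  shows "Q ** matrix_inv Q = mat 1"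
  using someI_ex[of "\<lambda>B. Q ** B = mat 1 \<and> B ** Q = mat 1"] assms
  unfolding invertible_def matrix_inv_def by blast

lemma matrix_diff_mult_rdistrib:
  fixes A B :: "'a::ring_1^'n^'m" and C :: "'a^'p^'n"
  shows "(A - B) ** C = A ** C - B ** C"
  by (simp add: matrix_matrix_mult_def vec_eq_iff left_diff_distrib sum_subtractf)

text \<open>
  If the row vector \<open>x\<close> annihilates the \<open>j\<close>-th column of \<open>Q\<close>, then expanding \<open>A\<^sub>k Q = Q B\<close> with
  \<open>B = Q\<inverse> A\<^sub>k Q\<close> gives \<open>x A\<^sub>k q\<^sub>j\<close> in terms of the off-diagonal entries of \<open>B\<close> alone. The diagonal
  entry, which \<open>offdiag_functional\<close> does not see, is multiplied by \<open>x q\<^sub>j = 0\<close>.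
\<close>

lemma offdiag_functional_lower:
  fixes A :: "'a::real_normed_field^'n^'n^'k"
  assumes Q: "invertible Q" and x: "(\<Sum>r\<in>UNIV. x $ r * Q $ r $ j) = 0"
  shows "norm (\<Sum>r\<in>UNIV. x $ r * (A $ k ** Q) $ r $ j)
     \<le> sqrt (2 * offdiag_functional A Q) * (\<Sum>i\<in>UNIV. norm (\<Sum>r\<in>UNIV. x $ r * Q $ r $ i))"
proof -
  define B where "B = matrix_inv Q ** A $ k ** Q"
  define y where "y i = (\<Sum>r\<in>UNIV. x $ r * Q $ r $ i)" for i
  have "A $ k ** Q = Q ** B"
    using Q by (simp add: B_def matrix_mul_assoc matrix_inv_right_inverse)
  then have "(\<Sum>r\<in>UNIV. x $ r * (A $ k ** Q) $ r $ j) = (\<Sum>r\<in>UNIV. \<Sum>i\<in>UNIV. x $ r * Q $ r $ i * B $ i $ j)"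
    by (simp add: matrix_matrix_mult_def sum_distrib_left mult.assoc)
  also have "\<dots> = (\<Sum>i\<in>UNIV. B $ i $ j * y i)"
    by (subst sum.swap) (simp add: y_def sum_distrib_left mult_ac)
  also have "norm \<dots> \<le> (\<Sum>i\<in>UNIV. norm (B $ i $ j * y i))"
    by (rule norm_sum)
  also have "\<dots> \<le> (\<Sum>i\<in>UNIV. sqrt (2 * offdiag_functional A Q) * norm (y i))"
  proof (rule sum_mono)
    fix i
    show "norm (B $ i $ j * y i) \<le> sqrt (2 * offdiag_functional A Q) * norm (y i)"
    proof (cases "i = j")
      case True
      then show ?thesis using x by (simp add: y_def)
    next
      case False
      then have "norm (B $ i $ j) \<le> sqrt (2 * offdiag_functional A Q)"
        unfolding B_def by (intro real_le_rsqrt offdiag_entry_le)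
      then show ?thesis by (simp add: norm_mult mult_right_mono)
    qed
  qed
  finally show ?thesis by (simp add: y_def sum_distrib_left)
qed

text \<open>
  The range of \<open>Z\<close> is a nontrivial subspace, hence some \<open>A\<^sub>k\<close> moves it out of itself; \<open>w\<close> is a row of
  \<open>mat 1 - P\<close> for a projection \<open>P\<close> onto that range.
\<close>

lemma noninvariant_range_functional:
  fixes A :: "'a::field^'n^'n^'k"
  assumes "\<not> has_common_nontrivial_invariant_subspace A" "Z \<noteq> 0" "det Z = 0"
  obtains w k j where "\<And>i. (\<Sum>r\<in>UNIV. w $ r * Z $ r $ i) = 0"
    "(\<Sum>r\<in>UNIV. w $ r * (A $ k ** Z) $ r $ j) \<noteq> 0"
proof -
  let ?M = "range ((*v) Z)"
  have "vec.subspace ?M"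
    using vec.linear_subspace_image[OF matrix_vector_mul_linear_gen vec.subspace_UNIV] .
  then obtain P where P: "range ((*v) P) = ?M" "\<And>x. x \<in> ?M \<longleftrightarrow> P *v x = x"
    using subspace_projection_matrix by blast
  have PZ: "P ** Z = Z"
    using P(2) by (auto simp: matrix_eq simp flip: matrix_vector_mul_assoc)
  have "\<exists>k. A $ k ** P \<noteq> P ** A $ k ** P"
  proof -
    have "P \<noteq> 0" using PZ \<open>Z \<noteq> 0\<close> by auto
    moreover have "det P = 0"
      using P(1) \<open>det Z = 0\<close> by (metis invertible_det_nz invertible_right_inverse matrix_right_invertible_surjective)
    ultimately show ?thesis using assms(1) unfolding reducible_iff_matrix_equation by blast
  qed
  then obtain k x where "A $ k *v (P *v x) \<noteq> P *v (A $ k *v (P *v x))"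
    by (auto simp: matrix_eq simp flip: matrix_vector_mul_assoc)
  moreover obtain y where "P *v x = Z *v y" using P(1) by blast
  ultimately have "(A $ k ** Z) *v y \<noteq> (P ** (A $ k ** Z)) *v y"
    by (simp flip: matrix_vector_mul_assoc)
  then have "(mat 1 - P) ** (A $ k ** Z) \<noteq> 0"
    by (auto simp: matrix_diff_mult_rdistrib)
  then obtain r j where r: "((mat 1 - P) ** (A $ k ** Z)) $ r $ j \<noteq> 0"
    by (auto simp: vec_eq_iff)
  show ?thesis
  proof (rule that[of "(mat 1 - P) $ r" k j])
    have "((mat 1 - P) ** Z) $ r $ i = 0" for i
      by (simp add: matrix_diff_mult_rdistrib PZ)
    then show "(\<Sum>s\<in>UNIV. (mat 1 - P) $ r $ s * Z $ s $ i) = 0" for i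
      by (simp add: matrix_matrix_mult_def)
    show "(\<Sum>s\<in>UNIV. (mat 1 - P) $ r $ s * (A $ k ** Z) $ s $ j) \<noteq> 0"
      using r by (simp add: matrix_matrix_mult_def[of "mat 1 - P"])
  qed
qed

text \<open>
  Apply \<open>offdiag_functional_lower\<close> to a perturbation \<open>x Q\<close> of the functional \<open>w\<close> from
  \<open>noninvariant_range_functional\<close>, chosen to annihilate the \<open>j\<close>-th column of \<open>Q\<close>. As \<open>Q\<close> tends to \<open>Z\<close>,
  the left side of the inequality tends to a positive limit and the sum on its right side to \<open>0\<close>.
\<close>

lemma offdiag_functional_at_top:
  fixes A :: "'a::real_normed_field^'n^'n^'k"
  assumes A: "\<not> has_common_nontrivial_invariant_subspace A" and Z: "Z \<noteq> 0" "det Z = 0"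
  shows "filterlim (offdiag_functional A) at_top (at Z within {Q. invertible Q})"
proof -
  obtain w k j where w: "\<And>i. (\<Sum>r\<in>UNIV. w $ r * Z $ r $ i) = 0"
    and c0: "(\<Sum>r\<in>UNIV. w $ r * (A $ k ** Z) $ r $ j) \<noteq> 0" (is "?c \<noteq> 0")
    by (rule noninvariant_range_functional[OF A Z], rule that)
  \<comment> \<open>The column \<open>z\<^sub>j\<close> is nonzero because \<open>w A\<^sub>k z\<^sub>j\<close> is; a nonzero coordinate of it is needed to correct \<open>w\<close>.\<close>
  have "\<exists>s. Z $ s $ j \<noteq> 0"
  proof (rule ccontr)
    assume "\<not> ?thesis"
    then have "(A $ k ** Z) $ r $ j = 0" for r by (simp add: matrix_matrix_mult_def)
    with c0 show False by simp
  qed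
  then obtain s where s: "Z $ s $ j \<noteq> 0" ..
  \<comment> \<open>The multiple \<open>\<alpha> Q\<close> of the \<open>s\<close>-th coordinate functional is the one that makes \<open>x Q\<close> annihilate \<open>q\<^sub>j\<close>.\<close>
  define \<alpha> where "\<alpha> Q = (\<Sum>r\<in>UNIV. w $ r * Q $ r $ j) / Q $ s $ j" for Q :: "'a^'n^'n"
  define x where "x Q = w - \<alpha> Q *s axis s 1" for Q :: "'a^'n^'n"
  let ?F = "at Z within {Q. invertible Q}"
  let ?l = "\<lambda>Q. norm (\<Sum>r\<in>UNIV. x Q $ r * (A $ k ** Q) $ r $ j)"
  let ?e = "\<lambda>Q. \<Sum>i\<in>UNIV. norm (\<Sum>r\<in>UNIV. x Q $ r * Q $ r $ i)"
  have \<alpha>: "(\<alpha> \<longlongrightarrow> 0) ?F"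
  proof -
    have "(\<alpha> \<longlongrightarrow> (\<Sum>r\<in>UNIV. w $ r * Z $ r $ j) / Z $ s $ j) ?F"
      unfolding \<alpha>_def using s by (intro tendsto_intros)
    then show ?thesis using w by simp
  qed
  have x: "((\<lambda>Q. x Q $ r) \<longlongrightarrow> w $ r) ?F" for r
    unfolding x_def by (auto intro!: tendsto_eq_intros \<alpha>)
  have "(?l \<longlongrightarrow> norm ?c) ?F"
    unfolding matrix_matrix_mult_def vec_lambda_beta by (intro tendsto_intros x)
  have "(?e \<longlongrightarrow> (\<Sum>i\<in>UNIV. norm (\<Sum>r\<in>UNIV. w $ r * Z $ r $ i))) ?F"
    by (intro tendsto_intros x)
  then have e: "(?e \<longlongrightarrow> 0) ?F" by (simp add: w)
  show ?thesis
    unfolding filterlim_at_top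
  proof
    fix C :: real
    \<comment> \<open>The absolute value keeps the radicand nonnegative for negative \<open>C\<close>; near \<open>Z\<close> a value below \<open>C\<close> would contradict the lower bound.\<close>
    have "((\<lambda>Q. sqrt (2 * \<bar>C\<bar>) * ?e Q) \<longlongrightarrow> sqrt (2 * \<bar>C\<bar>) * 0) ?F"
      by (intro tendsto_intros e)
    then have "((\<lambda>Q. ?l Q - sqrt (2 * \<bar>C\<bar>) * ?e Q) \<longlongrightarrow> norm ?c - 0) ?F"
      using \<open>(?l \<longlongrightarrow> norm ?c) ?F\<close> by (intro tendsto_diff) auto
    then have "\<forall>\<^sub>F Q in ?F. 0 < ?l Q - sqrt (2 * \<bar>C\<bar>) * ?e Q"
      using c0 by (auto dest: order_tendstoD(1)[where a = 0])
    moreover have "\<forall>\<^sub>F Q in ?F. Q $ s $ j \<noteq> 0"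
    proof -
      have "((\<lambda>Q. Q $ s $ j) \<longlongrightarrow> Z $ s $ j) ?F" by (intro tendsto_intros)
      then show ?thesis using s by (rule tendsto_imp_eventually_ne)
    qed
    moreover have "\<forall>\<^sub>F Q in ?F. invertible Q"
      by (simp add: eventually_at_filter)
    ultimately show "\<forall>\<^sub>F Q in ?F. C \<le> offdiag_functional A Q"
    proof eventually_elim
      case (elim Q)
      have "(\<Sum>r\<in>UNIV. x Q $ r * Q $ r $ j) = (\<Sum>r\<in>UNIV. w $ r * Q $ r $ j) - \<alpha> Q * Q $ s $ j"
        by (simp add: x_def axis_def left_diff_distrib sum_subtractf if_distrib[of "\<lambda>y. y * _"]
            if_distrib[of "\<lambda>y. _ * y"] cong: if_cong)
      also have "\<dots> = 0" using elim by (simp add: \<alpha>_def)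
      finally have le: "?l Q \<le> sqrt (2 * offdiag_functional A Q) * ?e Q"
        using elim by (intro offdiag_functional_lower)
      show ?case
      proof (rule ccontr)
        assume "\<not> ?case"
        then have "sqrt (2 * offdiag_functional A Q) * ?e Q \<le> sqrt (2 * \<bar>C\<bar>) * ?e Q"
          by (intro mult_right_mono sum_nonneg real_sqrt_le_mono) auto
        with le elim show False by linarith
      qed
    qed
  qed
qed

text \<open>
  Stated over any Euclidean normed field, so that the real and the complex case are instances of it.
\<close>

lemma abs_cont_prob_irreducible:
  fixes P :: "('a::{real_normed_field,euclidean_space}^'n^'n^'k::finite) measure"
  assumes "CARD('k) \<ge> 2" and P: "abs_cont_prob P"
  shows "{A. has_common_nontrivial_invariant_subspace A} \<in> null_sets P \<and>
        (AE A in P. \<forall>Z. Z \<noteq> 0 \<and> rank Z < CARD('n) \<longrightarrow>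
           filterlim (offdiag_functional A) at_top (at Z within {Q. invertible Q}))"
proof
  show null: "{A. has_common_nontrivial_invariant_subspace A} \<in> null_sets P"
    using null_sets_reducible[OF assms(1)] P unfolding abs_cont_prob_def absolutely_continuous_def by blast
  show "AE A in P. \<forall>Z. Z \<noteq> 0 \<and> rank Z < CARD('n) \<longrightarrow>
           filterlim (offdiag_functional A) at_top (at Z within {Q. invertible Q})"
    using AE_not_in[OF null]
    by eventually_elim (auto intro: offdiag_functional_at_top det_eq_0_if_rank_less)
qed

theorem proposition3p1:
  assumes "CARD('k::finite) \<ge> 2"
  shows
    "(\<forall>P :: (real^'n^'n^'k) measure. abs_cont_prob P \<longrightarrow>
        {A. has_common_nontrivial_invariant_subspace A} \<in> null_sets P \<and>
        (AE A in P. \<forall>Z. Z \<noteq> 0 \<and> rank Z < CARD('n) \<longrightarrow>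
           filterlim (offdiag_functional A) at_top (at Z within {Q. invertible Q})))
     \<and>
     (\<forall>P :: (complex^'n^'n^'k) measure. abs_cont_prob P \<longrightarrow>
        {A. has_common_nontrivial_invariant_subspace A} \<in> null_sets P \<and>
        (AE A in P. \<forall>Z. Z \<noteq> 0 \<and> rank Z < CARD('n) \<longrightarrow>
           filterlim (offdiag_functional A) at_top (at Z within {Q. invertible Q})))"
  by (rule conjI; intro allI impI; erule abs_cont_prob_irreducible[OF assms])

end
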